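(* The $h$-vector of a matroid simplicial complex of dimension $1$ is a pure $O$-sequence.
   Context: An (abstract) simplicial complex $\Delta$ on $[n]=\{1,\dots,n\}$ is a family of subsets of $[n]$ closed under taking subsets; its elements are faces, maximal faces are facets, and $\Delta$ is pure if all facets have the same cardinality. Its dimension is $d$ where $d+1$ is the maximal cardinality of a face. $\Delta$ is a matroid if for every $W\subseteq[n]$ the restriction $\{F\in\Delta: F\subseteq W\}$ is pure. The $f$-vector is $(f_{-1}=1,f_0,\dots,f_d)$ with $f_i$ the number of faces of cardinality $i+1$, and the $h$-vector $(h_0,\dots,h_{d+1})$ is defined by $\sum_{i=0}^{d+1}h_it^i=\sum_{i=0}^{d+1}f_{i-1}t^i(1-t)^{d+1-i}$ (trailing zeros are dropped). A pure $O$-sequence is the vector counting the monomials of each degree in a finite nonempty set of monomials closed under divisors whose maximal elements all have the same degree. *)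

theory Defs
  imports Main "HOL-Library.Multiset" "HOL-Computational_Algebra.Polynomial"
begin

text \<open>
  The void family is excluded, in accordance with the convention that there is exactly one
  empty face. Elements of \<open>{1..n}\<close> need not be vertices (matroids may have loops).
\<close>
definition simplicial_complex :: "nat \<Rightarrow> nat set set \<Rightarrow> bool" where
  "simplicial_complex n \<Delta> \<longleftrightarrow>
     \<Delta> \<noteq> {} \<and> \<Delta> \<subseteq> Pow {1..n} \<and> (\<forall>F\<in>\<Delta>. \<forall>G. G \<subseteq> F \<longrightarrow> G \<in> \<Delta>)"

definition facets :: "'a set set \<Rightarrow> 'a set set" where
  "facets \<Delta> = {F \<in> \<Delta>. \<forall>G\<in>\<Delta>. F \<subseteq> G \<longrightarrow> F = G}"

definition pure_complex :: "'a set set \<Rightarrow> bool" where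
  "pure_complex \<Delta> \<longleftrightarrow> (\<forall>F\<in>facets \<Delta>. \<forall>G\<in>facets \<Delta>. card F = card G)"

definition restriction :: "'a set set \<Rightarrow> 'a set \<Rightarrow> 'a set set" where
  "restriction \<Delta> W = {F \<in> \<Delta>. F \<subseteq> W}"

definition matroid_complex :: "nat \<Rightarrow> nat set set \<Rightarrow> bool" where
  "matroid_complex n \<Delta> \<longleftrightarrow>
     simplicial_complex n \<Delta> \<and> (\<forall>W. W \<subseteq> {1..n} \<longrightarrow> pure_complex (restriction \<Delta> W))"

definition complex_dim :: "'a set set \<Rightarrow> int" where
  "complex_dim \<Delta> = int (Max (card ` \<Delta>)) - 1"

definition f_num :: "'a set set \<Rightarrow> int \<Rightarrow> nat" where
  "f_num \<Delta> i = card {F \<in> \<Delta>. int (card F) = i + 1}"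

text \<open>Here \<open>[:0, 1:]\<close> is \<open>t\<close> and \<open>[:1, -1:]\<close> is \<open>1 - t\<close>.\<close>
definition h_poly :: "'a set set \<Rightarrow> int poly" where
  "h_poly \<Delta> = (let r = nat (complex_dim \<Delta> + 1) in
     \<Sum>i=0..r. of_nat (f_num \<Delta> (int i - 1)) * [:0, 1:] ^ i * [:1, -1:] ^ (r - i))"

text \<open>The list \<open>coeffs p\<close> starts with the constant coefficient and has no trailing zeros.\<close>
definition h_vector :: "'a set set \<Rightarrow> int list" where
  "h_vector \<Delta> = coeffs (h_poly \<Delta>)"

text \<open>
  A monomial in variables indexed by the natural numbers is the multiset of its variables:
  divisibility is \<open>\<subseteq>#\<close> and the degree is \<open>size\<close>. A finite set of
  monomials involves only finitely many variables.
\<close>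
type_synonym monomial = "nat multiset"

definition order_ideal :: "monomial set \<Rightarrow> bool" where
  "order_ideal M \<longleftrightarrow> finite M \<and> M \<noteq> {} \<and> (\<forall>m\<in>M. \<forall>m'. m' \<subseteq># m \<longrightarrow> m' \<in> M)"

definition maximal_monomials :: "monomial set \<Rightarrow> monomial set" where
  "maximal_monomials M = {m \<in> M. \<forall>m'\<in>M. m \<subseteq># m' \<longrightarrow> m = m'}"

definition pure_order_ideal :: "monomial set \<Rightarrow> bool" where
  "pure_order_ideal M \<longleftrightarrow> order_ideal M \<and>
     (\<forall>m\<in>maximal_monomials M. \<forall>m'\<in>maximal_monomials M. size m = size m')"

definition degree_vector :: "monomial set \<Rightarrow> int list" where
  "degree_vector M = map (\<lambda>i. int (card {m \<in> M. size m = i})) [0..<Suc (Max (size ` M))]"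

definition pure_O_sequence :: "int list \<Rightarrow> bool" where
  "pure_O_sequence hs \<longleftrightarrow> (\<exists>M. pure_order_ideal M \<and> hs = degree_vector M)"

end

theory Submission
  imports Defs
begin

text \<open>
  Fix an edge \<open>{a, b}\<close> and let the variables be the remaining vertices. The matroid property
  makes non-adjacency transitive, so every variable \<open>x\<close> is adjacent to \<open>a\<close> or to \<open>b\<close>.
  Take as quadratic monomials \<open>x y\<close> for each edge of the complex among the variables, and
  \<open>x\<^sup>2\<close> for each \<open>x\<close> adjacent to both \<open>a\<close> and \<open>b\<close>. Counting edges shows that there are exactly
  \<open>h\<^sub>2\<close> of them. If \<open>x\<close> divides none of them, then the complex is a star, and there are none at all.
\<close>

text \<open>The ideal consists of 1, the variables in \<open>V\<close> and the monomials in
  \<open>Q\<close>. By \<open>cover\<close>, once a quadratic monomial exists every variable divides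
  one, so no maximal monomial has degree below the top. If \<open>Q\<close> is empty, the variables,
  or else 1 alone, are the maximal monomials.\<close>

lemma pure_O_sequence_quadratic:
  fixes V :: "nat set" and Q :: "nat multiset set"
  assumes V: "finite V" and Q: "finite Q"
    and Q2: "\<And>m. m \<in> Q \<Longrightarrow> size m = 2 \<and> set_mset m \<subseteq> V"
    and cover: "\<And>x. Q \<noteq> {} \<Longrightarrow> x \<in> V \<Longrightarrow> \<exists>m\<in>Q. x \<in># m"
  shows "pure_O_sequence (coeffs [:1, int (card V), int (card Q):])"
proof -
  define M where "M = insert {#} ((\<lambda>x. {#x#}) ` V \<union> Q)"
  have finM: "finite M" using V Q by (simp add: M_def)
  have small: "m' \<in> M" if m': "size m' \<le> 1" "set_mset m' \<subseteq> V" for m'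
  proof (cases "size m' = 0")
    case True then show ?thesis by (simp add: M_def)
  next
    case False
    with m' have "size m' = 1" by linarith
    then obtain x where "m' = {#x#}" by (blast dest: size_1_singleton_mset)
    with m' show ?thesis by (auto simp: M_def)
  qed
  have sup: "size m \<le> 2 \<and> set_mset m \<subseteq> V \<and> (size m = 2 \<longrightarrow> m \<in> Q)" if "m \<in> M" for m
    using that Q2 by (auto simp: M_def)
  \<comment> \<open>All monomials of degree at most 1 over \<open>V\<close> lie in \<open>M\<close>,
    and a proper divisor of a monomial of degree at most 2 is one of these.\<close>
  have down: "m' \<in> M" if m: "m \<in> M" and sub: "m' \<subseteq># m" for m m'
  proof (cases "size m' \<le> 1")
    case True
    then show ?thesis using small sup[OF m] set_mset_mono[OF sub] by blast
  next
    case False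
    have "m' = m"
    proof (rule ccontr)
      assume "m' \<noteq> m"
      with sub have "m' \<subset># m" by (simp add: subset_mset.less_le)
      then have "size m' < size m" by (rule mset_subset_size)
      with sup[OF m] False show False by linarith
    qed
    then show ?thesis using m by simp
  qed
  have ideal: "order_ideal M"
    unfolding order_ideal_def using finM down by (auto simp: M_def)
  have "{m \<in> M. size m = 0} = {{#}}" by (auto simp: M_def)
  then have c0: "card {m \<in> M. size m = 0} = 1" by simp
  have l1: "{m \<in> M. size m = 1} = (\<lambda>x. {#x#}) ` V" using Q2 by (fastforce simp: M_def)
  have l2: "{m \<in> M. size m = 2} = Q" using Q2 by (auto simp: M_def)
  have c1: "card {m \<in> M. size m = 1} = card V"
    unfolding l1 by (rule card_image) (simp add: inj_on_def)
  define k :: nat where "k = (if Q \<noteq> {} then 2 else if V \<noteq> {} then 1 else 0)"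
  have k_ex: "\<exists>m\<in>M. size m = k"
    using Q2 by (fastforce simp: M_def k_def)
  have k_max: "size m \<le> k" if "m \<in> M" for m
    using that Q2 by (auto simp: M_def k_def)
  have Max: "Max (size ` M) = k"
    using finM k_ex k_max by (intro Max_eqI) auto
  \<comment> \<open>This yields purity: a maximal monomial equals its multiple of degree
    \<open>k\<close>.\<close>
  have extend: "\<exists>m'\<in>M. m \<subseteq># m' \<and> size m' = k" if m: "m \<in> M" for m
  proof (cases "size m = 0")
    case True then show ?thesis using k_ex by auto
  next
    case False
    show ?thesis
    proof (cases "size m = 1")
      case True
      with m l1 obtain x where x: "m = {#x#}" "x \<in> V" by blast
      show ?thesis
      proof (cases "Q = {}")
        case True
        with x m show ?thesis by (auto simp: k_def intro!: bexI[of _ m])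
      next
        case False
        from cover[OF this x(2)] obtain q where "q \<in> Q" "x \<in># q" by blast
        with False x Q2 show ?thesis by (auto simp: k_def M_def intro!: bexI[of _ q])
      qed
    next
      case False
      with \<open>size m \<noteq> 0\<close> sup[OF m] have "size m = 2" by linarith
      with sup[OF m] have "m \<in> Q" by blast
      then show ?thesis using m \<open>size m = 2\<close> by (auto simp: k_def)
    qed
  qed
  have "size m = k" if "m \<in> maximal_monomials M" for m
    using that extend[of m] by (auto simp: maximal_monomials_def)
  then have "pure_order_ideal M"
    unfolding pure_order_ideal_def using ideal by simp
  moreover have "coeffs [:1, int (card V), int (card Q):] = degree_vector M"
  proof -
    \<comment> \<open>\<open>coeffs\<close> drops trailing zeros, and the top degree
      \<open>k\<close> falls in exactly the same cases, so both lists have length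
      \<open>Suc k\<close>.\<close>
    consider "Q \<noteq> {}" | "Q = {}" "V \<noteq> {}" | "Q = {}" "V = {}" by blast
    then show ?thesis
    proof cases
      case 1
      then have "[0..<Suc k] = [0, 1, 2]" by (simp add: k_def upt_rec)
      then show ?thesis
        using 1 Q by (simp add: degree_vector_def Max c0[simplified] c1[simplified] l2 cCons_def del: upt_Suc)
    next
      case 2
      then have "[0..<Suc k] = [0, 1]" by (simp add: k_def upt_rec)
      then show ?thesis
        using 2 V by (simp add: degree_vector_def Max c0[simplified] c1[simplified] cCons_def del: upt_Suc)
    next
      case 3
      then have "[0..<Suc k] = [0]" by (simp add: k_def upt_rec)
      then show ?thesis
        using 3 by (simp add: degree_vector_def Max c0[simplified] cCons_def del: upt_Suc)
    qed
  qed
  ultimately show ?thesis unfolding pure_O_sequence_def by blast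
qed

text \<open>If both conclusions failed, the restriction to \<open>{x, y, z}\<close> would have the
  facets \<open>{y}\<close> and \<open>{x, z}\<close> of different cardinality. The case that
  \<open>y\<close> is \<open>x\<close> or \<open>z\<close> is harmless, since then one of the two
  sets is \<open>{y}\<close>.\<close>

lemma matroid_nonadjacency_trans:
  assumes m: "matroid_complex n \<Delta>"
    and xz: "{x, z} \<in> \<Delta>" "x \<noteq> z" and y: "{y} \<in> \<Delta>"
  shows "{x, y} \<in> \<Delta> \<or> {y, z} \<in> \<Delta>"
proof (rule ccontr)
  assume neg: "\<not> ({x, y} \<in> \<Delta> \<or> {y, z} \<in> \<Delta>)"
  have sc: "simplicial_complex n \<Delta>" using m by (simp add: matroid_complex_def)
  have sub: "G \<in> \<Delta>" if "F \<in> \<Delta>" "G \<subseteq> F" for F G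
    using sc that unfolding simplicial_complex_def by blast
  define W where "W = {x, y, z}"
  have "W \<subseteq> {1..n}" using sc xz y unfolding simplicial_complex_def W_def by blast
  then have pure: "pure_complex (restriction \<Delta> W)" using m by (simp add: matroid_complex_def)
  have no: "x \<notin> F \<and> z \<notin> F" if "F \<in> \<Delta>" "y \<in> F" for F
    using sub[OF that(1), of "{x, y}"] sub[OF that(1), of "{y, z}"] that(2) neg by blast
  have "{y} \<in> facets (restriction \<Delta> W)"
    using y no by (fastforce simp: facets_def restriction_def W_def)
  moreover have "{x, z} \<in> facets (restriction \<Delta> W)"
    using xz no by (fastforce simp: facets_def restriction_def W_def)
  ultimately have "card {y} = card {x, z}" using pure unfolding pure_complex_def by blast
  then show False using xz by simp
qed

text \<open>Expansion of \<open>(1 - t)^2 + f_0 t (1 - t) + f_1 t^2\<close>.\<close>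

lemma h_poly_dim_1:
  assumes "simplicial_complex n \<Delta>" and "complex_dim \<Delta> = 1"
  shows "h_poly \<Delta> =
    [:1, int (f_num \<Delta> 0) - 2, int (f_num \<Delta> 1) - int (f_num \<Delta> 0) + 1:]"
proof -
  have fin: "finite F" if "F \<in> \<Delta>" for F
    using assms(1) that finite_subset[of F "{1..n}"] by (auto simp: simplicial_complex_def)
  have "{} \<in> \<Delta>" using assms(1) by (auto simp: simplicial_complex_def)
  \<comment> \<open>Finiteness of faces matters here because \<open>card\<close> is 0 on infinite
    sets.\<close>
  then have "{F \<in> \<Delta>. int (card F) = - 1 + 1} = {{}}" using fin by auto
  then have f: "f_num \<Delta> (- 1) = 1" by (simp add: f_num_def)
  have "{0..2::nat} = {0, 1, 2}" by auto
  then show ?thesis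
    by (simp add: h_poly_def assms(2) f power2_eq_square of_nat_poly algebra_simps)
qed

theorem theorem4p11:
  fixes n :: nat and \<Delta> :: "nat set set"
  assumes "matroid_complex n \<Delta>"
    and "complex_dim \<Delta> = 1"
  shows "pure_O_sequence (h_vector \<Delta>)"
proof -
  have sc: "simplicial_complex n \<Delta>" using assms(1) by (simp add: matroid_complex_def)
  then have finD: "finite \<Delta>" and "\<Delta> \<noteq> {}"
    using finite_subset[of \<Delta> "Pow {1..n}"] by (auto simp: simplicial_complex_def)
  have sub: "G \<in> \<Delta>" if "F \<in> \<Delta>" "G \<subseteq> F" for F G
    using sc that unfolding simplicial_complex_def by blast
  have "Max (card ` \<Delta>) = 2" using assms(2) by (simp add: complex_dim_def)
  then have "2 \<in> card ` \<Delta>" using finD \<open>\<Delta> \<noteq> {}\<close> Max_in[of "card ` \<Delta>"] by simp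
  then obtain e where "e \<in> \<Delta>" "card e = 2" by auto
  then obtain a b where ab: "a \<noteq> b" "{a, b} \<in> \<Delta>" by (metis card_2_iff)
  \<comment> \<open>Loops are left out together with \<open>a\<close> and \<open>b\<close>, so that
    \<open>card V\<close> is \<open>f_0 - 2\<close>, which is \<open>h_1\<close>.\<close>
  define V where "V = {x. {x} \<in> \<Delta>} - {a, b}"
  define A where "A = {x \<in> V. {a, x} \<in> \<Delta>}"
  define B where "B = {x \<in> V. {b, x} \<in> \<Delta>}"
  define E where "E = {F \<in> \<Delta>. card F = 2 \<and> F \<subseteq> V}"
  define Q where "Q = mset_set ` E \<union> (\<lambda>x. {#x, x#}) ` (A \<inter> B)"
  have vert: "{x} \<in> \<Delta>" if "F \<in> \<Delta>" "x \<in> F" for x F using sub that by blast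
  have finX: "finite {x. {x} \<in> \<Delta>}"
    using finite_vimageI[OF finD, of "\<lambda>x. {x}"] by (simp add: vimage_def inj_def)
  then have finV: "finite V" by (simp add: V_def)
  have finAB: "finite A" "finite B" using finV by (simp_all add: A_def B_def)
  have finE: "finite E" using finD by (simp add: E_def)
  \<comment> \<open>Non-adjacency is transitive, so a vertex joined to neither \<open>a\<close> nor
    \<open>b\<close> would contradict the edge \<open>{a, b}\<close>.\<close>
  have AB: "A \<union> B = V"
    using matroid_nonadjacency_trans[OF assms(1) ab(2,1)]
    by (auto simp: A_def B_def V_def insert_commute)
  have f0: "f_num \<Delta> 0 = card V + 2"
  proof -
    have "{F \<in> \<Delta>. int (card F) = 0 + 1} = (\<lambda>x. {x}) ` {x. {x} \<in> \<Delta>}"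
      by (auto simp: card_1_singleton_iff)
    then have "f_num \<Delta> 0 = card {x. {x} \<in> \<Delta>}"
      by (simp add: f_num_def card_image)
    also have "{x. {x} \<in> \<Delta>} = insert a (insert b V)"
      using vert[OF ab(2)] by (auto simp: V_def)
    also have "card \<dots> = card V + 2" using ab(1) finV by (simp add: V_def)
    finally show ?thesis .
  qed
  \<comment> \<open>Sort the edges by how they meet \<open>{a, b}\<close>: that edge itself, those
    inside \<open>V\<close>, those from \<open>a\<close> into \<open>A\<close>, and those from
    \<open>b\<close> into \<open>B\<close>.\<close>
  have f1: "f_num \<Delta> 1 = 1 + card E + card A + card B"
  proof -
    have edge: "F \<in> insert {a, b} (E \<union> insert a ` (\<lambda>x. {x}) ` A \<union> insert b ` (\<lambda>x. {x}) ` B)"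
      if F: "F \<in> \<Delta>" "card F = 2" for F
    proof -
      obtain x y where xy: "F = {x, y}" "x \<noteq> y" using F(2) by (metis card_2_iff)
      have "{x} \<in> \<Delta>" "{y} \<in> \<Delta>" using vert F(1) xy by blast+
      then show ?thesis
        using F xy by (auto simp: E_def A_def B_def V_def insert_commute image_image)
    qed
    have "{F \<in> \<Delta>. int (card F) = 1 + 1} = {F \<in> \<Delta>. card F = 2}" by auto
    also have "\<dots> = insert {a, b} (E \<union> insert a ` (\<lambda>x. {x}) ` A \<union> insert b ` (\<lambda>x. {x}) ` B)"
      using edge ab by (auto simp: E_def A_def B_def V_def card_insert_if)
    also have "card \<dots> = 1 + card (E \<union> insert a ` (\<lambda>x. {x}) ` A \<union> insert b ` (\<lambda>x. {x}) ` B)"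
      using finE finAB by (subst card_insert_disjoint) (auto simp: E_def A_def B_def V_def doubleton_eq_iff)
    also have "card (E \<union> insert a ` (\<lambda>x. {x}) ` A \<union> insert b ` (\<lambda>x. {x}) ` B) =
        card E + card (insert a ` (\<lambda>x. {x}) ` A) + card (insert b ` (\<lambda>x. {x}) ` B)"
      using finE finAB ab(1)
      by (subst card_Un_disjoint; (subst card_Un_disjoint)?)
         (auto simp: E_def A_def B_def V_def doubleton_eq_iff)
    also have "card (insert a ` (\<lambda>x. {x}) ` A) = card A"
      unfolding image_image by (rule card_image) (auto simp: inj_on_def doubleton_eq_iff)
    also have "card (insert b ` (\<lambda>x. {x}) ` B) = card B"
      unfolding image_image by (rule card_image) (auto simp: inj_on_def doubleton_eq_iff)
    finally show ?thesis by (simp add: f_num_def)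
  qed
  have cardAB: "card A + card B = card V + card (A \<inter> B)"
    using card_Un_Int[OF finAB] AB by simp
  \<comment> \<open>Needed for injectivity of \<open>mset_set\<close>, which sends every infinite
    set to the empty multiset.\<close>
  have finF: "finite F" if "F \<in> E" for F
    using that finV finite_subset by (auto simp: E_def)
  have cardQ: "card Q = card E + card (A \<inter> B)"
  proof -
    have "inj_on mset_set E"
      by (rule inj_onI) (metis finF finite_set_mset_mset_set)
    \<comment> \<open>Edge monomials are squarefree, hence different from the squares.\<close>
    moreover have "mset_set F \<noteq> {#x, x#}" for F :: "nat set" and x
    proof
      assume "mset_set F = {#x, x#}"
      then have "count (mset_set F) x = 2" by simp
      then show False by (simp add: count_mset_set' split: if_splits)
    qed
    then have "mset_set ` E \<inter> (\<lambda>x. {#x, x#}) ` (A \<inter> B) = {}" by blast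
    moreover have "inj_on (\<lambda>x. {#x, x#}) (A \<inter> B)"
      by (rule inj_onI) (auto simp: add_eq_conv_ex)
    ultimately show ?thesis
      unfolding Q_def using finE finAB by (subst card_Un_disjoint) (auto simp: card_image)
  qed
  have star: "E = {} \<and> A \<inter> B = {}"
    if x: "x \<in> V" "\<And>m. m \<in> Q \<Longrightarrow> x \<notin># m" for x
  proof -
    \<comment> \<open>Every edge contains \<open>x\<close> or has an end joined to \<open>x\<close>;
      the two arguments below play this off against the isolation of \<open>x\<close> within
      \<open>V\<close>.\<close>
    have trans: "{y, x} \<in> \<Delta> \<or> {x, z} \<in> \<Delta>" if "{y, z} \<in> \<Delta>" "y \<noteq> z" for y z
      using matroid_nonadjacency_trans[OF assms(1) that, of x] x(1) by (simp add: V_def)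
    have isolated: "{x, y} \<notin> \<Delta>" if y: "y \<in> V" "x \<noteq> y" for y
    proof
      assume "{x, y} \<in> \<Delta>"
      then have "{x, y} \<in> E" using x(1) y by (simp add: E_def)
      then have "mset_set {x, y} \<in> Q" unfolding Q_def by blast
      from x(2)[OF this] show False by simp
    qed
    \<comment> \<open>Otherwise the square of \<open>x\<close> would be a monomial in
      \<open>Q\<close> divisible by \<open>x\<close>.\<close>
    have xAB: "x \<notin> A \<inter> B" using x(2)[of "{#x, x#}"] by (auto simp: Q_def)
    have "F \<notin> E" for F
    proof
      assume F: "F \<in> E"
      then obtain y z where yz: "F = {y, z}" "y \<noteq> z" by (auto simp: E_def card_2_iff)
      with F have "{y, z} \<in> \<Delta>" "y \<in> V" "z \<in> V" by (auto simp: E_def)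
      with trans[of y z] isolated[of y] isolated[of z] yz(2) show False
        by (metis insert_commute)
    qed
    \<comment> \<open>As \<open>x\<close> is not joined to \<open>y\<close>, the edges
      \<open>{a, y}\<close> and \<open>{b, y}\<close> force \<open>x\<close> to be joined to both
      \<open>a\<close> and \<open>b\<close>, against \<open>xAB\<close>.\<close>
    moreover have "y \<notin> A \<inter> B" for y
    proof
      assume y: "y \<in> A \<inter> B"
      then have "x \<noteq> y" "y \<in> V" using xAB by (auto simp: A_def)
      with isolated have "{x, y} \<notin> \<Delta>" by blast
      with y trans[of a y] trans[of b y] have "{a, x} \<in> \<Delta>" "{b, x} \<in> \<Delta>"
        by (auto simp: A_def B_def V_def)
      with x(1) xAB show False by (simp add: A_def B_def)
    qed
    ultimately show ?thesis by blast
  qed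
  have "pure_O_sequence (coeffs [:1, int (card V), int (card Q):])"
  proof (rule pure_O_sequence_quadratic)
    show "finite V" "finite Q" using finV finE finAB by (simp_all add: Q_def)
    show "size m = 2 \<and> set_mset m \<subseteq> V" if "m \<in> Q" for m
    proof -
      have "card F = 2 \<and> F \<subseteq> V \<and> finite F" if "F \<in> E" for F
        using that finF[OF that] by (simp add: E_def)
      moreover have "A \<inter> B \<subseteq> V" using AB by blast
      ultimately show ?thesis using that by (fastforce simp: Q_def)
    qed
    show "\<exists>m\<in>Q. x \<in># m" if "Q \<noteq> {}" "x \<in> V" for x
    proof (rule ccontr)
      assume "\<not> (\<exists>m\<in>Q. x \<in># m)"
      with star[OF that(2)] have "E = {} \<and> A \<inter> B = {}" by blast
      with that(1) show False by (simp add: Q_def)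
    qed
  qed
  \<comment> \<open>With \<open>f0\<close>, \<open>f1\<close> and inclusion-exclusion for
    \<open>A\<close> and \<open>B\<close>, the coefficient \<open>f_1 - f_0 + 1\<close> becomes
    \<open>card E + card (A \<inter> B)\<close>, which is \<open>card Q\<close>.\<close>
  moreover have "h_poly \<Delta> = [:1, int (card V), int (card Q):]"
    using h_poly_dim_1[OF sc assms(2)] f0 f1 cardAB cardQ by simp
  ultimately show ?thesis by (simp add: h_vector_def)
qed

end
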